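(* Let $0<\alpha\le\beta$, let $n,d\ge1$ be integers, $\rho>0$, and let $A=(a_{i,j})\in\mathbb{R}_+^{n\times n}$ be a mixing matrix satisfying the assumptions stated in the context, with $\lambda_n$ the largest eigenvalue of its graph Laplacian $L$. Let $f_i^k\in\mathcal{F}_{\alpha,\beta}$ for all $i\in\{1,\dots,n\}$ and all integers $k\ge0$ (the functions may change arbitrarily with $k$), and let the step size satisfy $0<\eta\le 1/(\beta+\rho\lambda_n)$. Consider a sequence $\boldsymbol{x}^k=(x_1^k,\dots,x_n^k)\in(\mathbb{R}^d)^n\cong\mathbb{R}^{nd}$, $k\ge 0$, generated by $$x_i^{k+1}=x_i^k-\eta\Big(\nabla f_i^k(x_i^k)+\rho\sum_{j=1}^n a_{i,j}(x_i^k-x_j^k)\Big),\qquad i=1,\dots,n.$$ Let $\kappa_\rho=\frac{\beta+\rho\lambda_n}{\alpha}$, $\kappa=\beta/\alpha$, and $$R=\begin{cases}(1+\sqrt{6})\sqrt{n}\,(1+\sqrt{\kappa}) & \text{if }\kappa_\rho<3,\\ (1+\sqrt{2\kappa_\rho})\sqrt{n}\,(1+\sqrt{\kappa}) & \text{otherwise.}\end{cases}$$ If $\|\boldsymbol{x}^{k_0}\|\le R$ at some iteration $k_0$, then $\|\boldsymbol{x}^k\|\le R$ for all $k\ge k_0$.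
   Context: $\|\cdot\|$ is the Euclidean norm. $\mathcal{F}_{\alpha,\beta}$ is the set of continuously differentiable functions $g:\mathbb{R}^d\to\mathbb{R}$ such that: $g$ is $\alpha$-strongly convex (i.e. $g(x)-\frac{\alpha}{2}\|x\|^2$ is convex); $g$ is $\beta$-smooth (i.e. $\|\nabla g(x)-\nabla g(y)\|\le\beta\|x-y\|$ for all $x,y$); $\min_x g(x)=0$; and the minimizer of $g$ has norm at most $1$. Assumptions on $A\in\mathbb{R}_+^{n\times n}$ (entries nonnegative): $A$ is symmetric; all diagonal entries $a_{i,i}$ are strictly positive; $A$ is primitive, i.e. there is an integer $k>0$ such that every entry of $A^k$ is positive. The graph Laplacian is $L=D-A$, where $D$ is the diagonal matrix with $D_{i,i}=\sum_j a_{i,j}$. *)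

theory Defs
  imports "HOL-Analysis.Analysis"
begin

definition grad :: "('a::real_inner \<Rightarrow> real) \<Rightarrow> 'a \<Rightarrow> 'a" where
  "grad g x = (THE D. GDERIV g x :> D)"

definition continuously_differentiable :: "('a::euclidean_space \<Rightarrow> real) \<Rightarrow> bool" where
  "continuously_differentiable g \<longleftrightarrow>
     (\<forall>x. g differentiable (at x)) \<and> continuous_on UNIV (grad g)"

definition strongly_convex :: "real \<Rightarrow> ('a::euclidean_space \<Rightarrow> real) \<Rightarrow> bool" where
  "strongly_convex \<alpha> g \<longleftrightarrow> convex_on UNIV (\<lambda>x. g x - \<alpha> / 2 * (norm x)\<^sup>2)"

definition smooth_fun :: "real \<Rightarrow> ('a::euclidean_space \<Rightarrow> real) \<Rightarrow> bool" where
  "smooth_fun \<beta> g \<longleftrightarrow> (\<forall>x y. norm (grad g x - grad g y) \<le> \<beta> * norm (x - y))"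

text \<open>For \<open>\<alpha> > 0\<close> the minimizer is unique, so the existential below speaks of
  \<^emph>\<open>the\<close> minimizer.\<close>

definition F_class :: "real \<Rightarrow> real \<Rightarrow> ('a::euclidean_space \<Rightarrow> real) set" where
  "F_class \<alpha> \<beta> = {g. continuously_differentiable g \<and> strongly_convex \<alpha> g \<and> smooth_fun \<beta> g \<and>
     (\<exists>z. (\<forall>y. g z \<le> g y) \<and> g z = 0 \<and> norm z \<le> 1)}"

text \<open>The library's multiplication (hence power) on type \<open>vec\<close> is componentwise,
  so powers of a matrix are iterated explicitly with the matrix product.\<close>

primrec matrix_power :: "real^'n^'n \<Rightarrow> nat \<Rightarrow> real^'n^'n" where
  "matrix_power A 0 = mat 1"
| "matrix_power A (Suc k) = A ** matrix_power A k"

definition primitive_matrix :: "real^'n^'n \<Rightarrow> bool" where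
  "primitive_matrix A \<longleftrightarrow> (\<exists>k>0. \<forall>i j. 0 < matrix_power A k $ i $ j)"

definition mixing_matrix :: "real^'n^'n \<Rightarrow> bool" where
  "mixing_matrix A \<longleftrightarrow>
     (\<forall>i j. 0 \<le> A $ i $ j) \<and> transpose A = A \<and> (\<forall>i. 0 < A $ i $ i) \<and> primitive_matrix A"

definition degree_matrix :: "real^'n^'n \<Rightarrow> real^'n^'n" where
  "degree_matrix A = (\<chi> i j. if i = j then (\<Sum>l\<in>UNIV. A $ i $ l) else 0)"

definition laplacian :: "real^'n^'n \<Rightarrow> real^'n^'n" where
  "laplacian A = degree_matrix A - A"

definition is_eigenvalue :: "real^'n^'n \<Rightarrow> real \<Rightarrow> bool" where
  "is_eigenvalue M \<mu> \<longleftrightarrow> (\<exists>v. v \<noteq> 0 \<and> M *v v = \<mu> *\<^sub>R v)"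

definition largest_eigenvalue :: "real^'n^'n \<Rightarrow> real" where
  "largest_eigenvalue M = (GREATEST \<mu>. is_eigenvalue M \<mu>)"

end

theory Submission
  imports Defs
begin

text \<open>
  One round of the iteration is a gradient step for
  \<open>F(x) = \<Sum>\<^sub>i f\<^sub>i(x\<^sub>i) + \<rho>/2 \<langle>x, (L \<otimes> I) x\<rangle>\<close>, which is nonnegative,
  \<open>\<alpha>\<close>-strongly convex, and \<open>M\<close>-smooth with \<open>M = \<beta> + \<rho> \<lambda>\<^sub>n\<close>. Instead of tracking the minimizer
  of \<open>F\<close>, compare with the origin: strong convexity gives
  \<open>\<langle>\<nabla>F(x), x\<rangle> \<ge> F(x) - F(0) + \<alpha>/2 \<parallel>x\<parallel>\<^sup>2\<close>, smoothness and \<open>F \<ge> 0\<close> give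
  \<open>\<parallel>\<nabla>F(x)\<parallel>\<^sup>2 \<le> 2 M F(x)\<close>, and \<open>F(0) \<le> n \<beta> / 2\<close>. With \<open>\<eta> M \<le> 1\<close> this yields
  \<open>\<parallel>x - \<eta> \<nabla>F(x)\<parallel>\<^sup>2 \<le> (1 - \<eta> \<alpha>) \<parallel>x\<parallel>\<^sup>2 + \<eta> n \<beta>\<close>, so every ball around the origin of squared
  radius at least \<open>n \<kappa>\<close> is invariant.
\<close>

section \<open>Gradients and first-order bounds\<close>

text \<open>Since \<open>grad\<close> is a definite description, both existence and uniqueness of
  the representing vector are required. Existence comes from expanding the linear derivative in the
  basis, uniqueness from that of the derivative.\<close>

lemma GDERIV_grad:
  fixes g :: "'a::euclidean_space \<Rightarrow> real"
  assumes "g differentiable (at x)"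
  shows "GDERIV g x :> grad g x"
proof -
  obtain D where D: "(g has_derivative D) (at x)"
    using assms by (auto simp: differentiable_def)
  then have lin: "linear D"
    by (simp add: has_derivative_linear)
  define d where "d = (\<Sum>b\<in>Basis. D b *\<^sub>R b)"
  have "D h = h \<bullet> d" for h
  proof -
    have "D h = D (\<Sum>b\<in>Basis. (h \<bullet> b) *\<^sub>R b)"
      by (simp add: euclidean_representation)
    also have "\<dots> = h \<bullet> d"
      by (simp add: linear_sum[OF lin] linear_cmul[OF lin] d_def inner_sum_right mult.commute)
    finally show ?thesis .
  qed
  then have d: "GDERIV g x :> d"
    using D unfolding gderiv_def by (metis (no_types, lifting) ext)
  have "d' = d" if "GDERIV g x :> d'" for d'
  proof -
    have "(\<lambda>h. h \<bullet> d') = (\<lambda>h. h \<bullet> d)"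
      using that d unfolding gderiv_def by (rule has_derivative_unique)
    then have "\<forall>h. h \<bullet> d' = h \<bullet> d"
      by (rule fun_cong[THEN allI])
    then show ?thesis
      by (simp only: vector_eq_ldot)
  qed
  then have "grad g x = d"
    unfolding grad_def using d by (intro the_equality)
  then show ?thesis
    using d by simp
qed

lemma DERIV_along_line:
  fixes g :: "'a::euclidean_space \<Rightarrow> real"
  assumes "g differentiable (at (x + t *\<^sub>R h))"
  shows "((\<lambda>t. g (x + t *\<^sub>R h)) has_real_derivative h \<bullet> grad g (x + t *\<^sub>R h)) (at t)"
proof -
  have "((\<lambda>t. x + t *\<^sub>R h) has_derivative (\<lambda>s. s *\<^sub>R h)) (at t)"
    by (auto intro!: derivative_eq_intros)
  moreover have "(g has_derivative (\<lambda>v. v \<bullet> grad g (x + t *\<^sub>R h))) (at (x + t *\<^sub>R h))"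
    using GDERIV_grad[OF assms] by (simp add: gderiv_def)
  ultimately have "((\<lambda>t. g (x + t *\<^sub>R h)) has_derivative (\<lambda>s. s *\<^sub>R h \<bullet> grad g (x + t *\<^sub>R h))) (at t)"
    by (rule has_derivative_compose)
  then show ?thesis
    by (simp add: has_field_derivative_def mult.commute[of "h \<bullet> _"] mult_commute_abs)
qed

lemma smooth_fun_upper_bound:
  fixes g :: "'a::euclidean_space \<Rightarrow> real"
  assumes diff: "\<And>x. g differentiable (at x)" and "smooth_fun \<beta> g"
  shows "g (x + h) \<le> g x + grad g x \<bullet> h + \<beta> / 2 * (norm h)\<^sup>2"
proof -
  define p where "p t = g (x + t *\<^sub>R h) - t * (h \<bullet> grad g x) - \<beta> / 2 * t\<^sup>2 * (norm h)\<^sup>2" for t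
  have "p 1 \<le> p 0"
  proof (rule DERIV_nonpos_imp_nonincreasing[where f = p])
    fix t :: real
    assume t: "0 \<le> t" "t \<le> 1"
    let ?D = "h \<bullet> grad g (x + t *\<^sub>R h) - h \<bullet> grad g x - \<beta> * t * (norm h)\<^sup>2"
    have "(p has_real_derivative ?D) (at t)"
      unfolding p_def by (auto intro!: derivative_eq_intros DERIV_along_line diff)
    moreover have "?D \<le> 0"
    proof -
      have "h \<bullet> grad g (x + t *\<^sub>R h) - h \<bullet> grad g x = h \<bullet> (grad g (x + t *\<^sub>R h) - grad g x)"
        by (simp add: inner_diff_right)
      also have "\<dots> \<le> norm h * norm (grad g (x + t *\<^sub>R h) - grad g x)"
        by (rule norm_cauchy_schwarz)
      also have "\<dots> \<le> norm h * (\<beta> * norm (x + t *\<^sub>R h - x))"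
        using assms(2) unfolding smooth_fun_def by (intro mult_left_mono norm_ge_zero) blast
      also have "\<dots> = \<beta> * t * (norm h)\<^sup>2"
        using t by (simp add: power2_eq_square)
      finally show ?thesis by simp
    qed
    ultimately show "\<exists>y. DERIV p t :> y \<and> y \<le> 0" by blast
  qed simp
  then show ?thesis
    by (simp add: p_def inner_commute)
qed

text \<open>The convex function \<open>c\<close> restricted to the line through \<open>x\<close> in
  direction \<open>h\<close> lies above its tangent at 0; this is evaluated at 1.\<close>

lemma strongly_convex_lower_bound:
  fixes g :: "'a::euclidean_space \<Rightarrow> real"
  assumes diff: "\<And>x. g differentiable (at x)" and "strongly_convex \<alpha> g"
  shows "g x + grad g x \<bullet> h + \<alpha> / 2 * (norm h)\<^sup>2 \<le> g (x + h)"
proof -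
  define c where "c v = g v - \<alpha> / 2 * (norm v)\<^sup>2" for v
  define p where "p t = c (x + t *\<^sub>R h)" for t :: real
  have "convex_on UNIV c"
    using assms(2) by (simp add: strongly_convex_def c_def[abs_def])
  then have conv: "convex_on UNIV p"
    unfolding convex_on_def p_def
  proof safe
    fix u v s t :: real
    assume cv: "\<forall>x\<in>UNIV. \<forall>y\<in>UNIV. \<forall>u\<ge>0. \<forall>v\<ge>0. u + v = 1 \<longrightarrow>
        c (u *\<^sub>R x + v *\<^sub>R y) \<le> u * c x + v * c y"
      and uv: "0 \<le> u" "0 \<le> v" "u + v = 1"
    have "x + (u *\<^sub>R s + v *\<^sub>R t) *\<^sub>R h = (u + v) *\<^sub>R x + (u *\<^sub>R s + v *\<^sub>R t) *\<^sub>R h"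
      using uv by simp
    also have "\<dots> = u *\<^sub>R (x + s *\<^sub>R h) + v *\<^sub>R (x + t *\<^sub>R h)"
      by (simp add: algebra_simps)
    finally show "c (x + (u *\<^sub>R s + v *\<^sub>R t) *\<^sub>R h) \<le> u * c (x + s *\<^sub>R h) + v * c (x + t *\<^sub>R h)"
      using cv uv by simp
  qed simp
  \<comment> \<open>With the squared norm expanded, the term
    \<open>\<alpha> * (x \<bullet> h)\<close> occurs both in the slope at 0 and in
    \<open>p 1 - p 0\<close>, and cancels.\<close>
  have p_alt: "p t = g (x + t *\<^sub>R h) - \<alpha> / 2 * ((norm x)\<^sup>2 + 2 * t * (x \<bullet> h) + t\<^sup>2 * (norm h)\<^sup>2)" for t
    unfolding p_def c_def power2_norm_eq_inner
    by (simp add: inner_simps inner_commute power2_eq_square algebra_simps)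
  have "((\<lambda>t. g (x + t *\<^sub>R h)) has_real_derivative h \<bullet> grad g (x + 0 *\<^sub>R h)) (at 0)"
    by (intro DERIV_along_line diff)
  then have "(p has_real_derivative h \<bullet> grad g x - \<alpha> * (x \<bullet> h)) (at 0)"
    unfolding p_alt[abs_def] by (auto intro!: derivative_eq_intros)
  then have "p 1 - p 0 \<ge> (h \<bullet> grad g x - \<alpha> * (x \<bullet> h)) * (1 - 0)"
    by (intro convex_on_imp_above_tangent[OF conv]) auto
  then show ?thesis
    by (simp add: p_alt inner_commute algebra_simps)
qed

section \<open>Bounds for the function class\<close>

lemma F_class_differentiable: "g \<in> F_class \<alpha> \<beta> \<Longrightarrow> g differentiable (at x)"
  by (simp add: F_class_def continuously_differentiable_def)

lemma F_class_nonneg: "g \<in> F_class \<alpha> \<beta> \<Longrightarrow> 0 \<le> g x"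
  unfolding F_class_def by (smt (verit) mem_Collect_eq)

lemma F_class_upper_bound:
  "g \<in> F_class \<alpha> \<beta> \<Longrightarrow> g (x + h) \<le> g x + grad g x \<bullet> h + \<beta> / 2 * (norm h)\<^sup>2"
  by (rule smooth_fun_upper_bound) (auto simp: F_class_differentiable, simp add: F_class_def)

lemma F_class_lower_bound:
  "g \<in> F_class \<alpha> \<beta> \<Longrightarrow> g x + grad g x \<bullet> h + \<alpha> / 2 * (norm h)\<^sup>2 \<le> g (x + h)"
  by (rule strongly_convex_lower_bound) (auto simp: F_class_differentiable, simp add: F_class_def)

text \<open>The gradient vanishes at the minimizer \<open>z\<close>, so the quadratic upper bound
  from \<open>z\<close> to 0 leaves only \<open>\<beta> / 2 * (norm z)\<^sup>2\<close>.\<close>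

lemma F_class_at_0:
  assumes g: "g \<in> F_class \<alpha> \<beta>" and "0 < \<beta>"
  shows "g 0 \<le> \<beta> / 2"
proof -
  obtain z where z: "g z = 0" "norm z \<le> 1"
    using g by (auto simp: F_class_def)
  let ?d = "grad g z"
  \<comment> \<open>A gradient step of length 1/\<beta> from \<open>z\<close> would push the value
    below 0 unless the gradient there is zero.\<close>
  have "0 \<le> g (z + (- (1 / \<beta>)) *\<^sub>R ?d)"
    using g by (rule F_class_nonneg)
  also have "\<dots> \<le> g z + ?d \<bullet> ((- (1 / \<beta>)) *\<^sub>R ?d) + \<beta> / 2 * (norm ((- (1 / \<beta>)) *\<^sub>R ?d))\<^sup>2"
    using g by (rule F_class_upper_bound)
  also have "\<dots> = - (norm ?d)\<^sup>2 / (2 * \<beta>)"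
    using \<open>0 < \<beta>\<close> z by (simp add: dot_square_norm power_mult_distrib field_simps power2_eq_square)
  finally have "?d = 0"
    using \<open>0 < \<beta>\<close> by (simp add: divide_le_0_iff)
  then have "g 0 \<le> \<beta> / 2 * (norm z)\<^sup>2"
    using F_class_upper_bound[OF g, of z "- z"] z by simp
  also have "\<dots> \<le> \<beta> / 2 * 1"
    using \<open>0 < \<beta>\<close> z by (intro mult_left_mono) (auto simp: power_le_one)
  finally show ?thesis by simp
qed

section \<open>Largest eigenvalue and Rayleigh quotient\<close>

text \<open>By compactness the quadratic form has a maximizer \<open>u\<close> on the unit sphere.
  Its value \<open>m\<close> is an eigenvalue and dominates all others, which also shows that the
  \<open>GREATEST\<close> in the definition is attained.\<close>

lemma rayleigh_le_largest_eigenvalue: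
  fixes M :: "real^'n^'n"
  assumes sym: "transpose M = M"
  shows "v \<bullet> (M *v v) \<le> largest_eigenvalue M * (norm v)\<^sup>2"
proof -
  have "continuous_on (sphere 0 1) (\<lambda>v. v \<bullet> (M *v v))"
    by (intro continuous_intros linear_continuous_on matrix_vector_mul_bounded_linear)
  moreover have "sphere 0 1 \<noteq> ({} :: (real^'n) set)"
    by simp
  ultimately obtain u where u: "norm u = 1"
    and umax: "\<And>w. norm w = 1 \<Longrightarrow> w \<bullet> (M *v w) \<le> u \<bullet> (M *v u)"
    using continuous_attains_sup[of "sphere 0 1" "\<lambda>v. v \<bullet> (M *v v)"] by auto
  define m where "m = u \<bullet> (M *v u)"
  \<comment> \<open>The quadratic form of \<open>m I - M\<close>: nonnegative on unit vectors by
    maximality, hence everywhere by homogeneity, and zero at \<open>u\<close>.\<close>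
  define p where "p v = m * (v \<bullet> v) - v \<bullet> (M *v v)" for v
  have p_nonneg: "0 \<le> p v" for v
  proof (cases "v = 0")
    case True
    then show ?thesis by (simp add: p_def)
  next
    case False
    define w where "w = (1 / norm v) *\<^sub>R v"
    have v: "v = norm v *\<^sub>R w" and "norm w = 1"
      using False by (auto simp: w_def)
    then have "(norm v)\<^sup>2 * (w \<bullet> (M *v w)) \<le> (norm v)\<^sup>2 * m"
      unfolding m_def by (intro mult_left_mono umax) auto
    moreover have "v \<bullet> (M *v v) = (norm v)\<^sup>2 * (w \<bullet> (M *v w))"
      by (subst (1 2) v) (simp add: matrix_vector_mult_scaleR power2_eq_square)
    ultimately show ?thesis
      by (simp add: p_def power2_norm_eq_inner mult.commute)
  qed
  \<comment> \<open>The residual of the eigenvector equation. Along \<open>u + t w\<close> the form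
    \<open>p\<close> has no constant term and slope \<open>- 2 * (norm w)\<^sup>2\<close> at 0, so a
    nonzero \<open>w\<close> would make it negative for small positive \<open>t\<close>.\<close>
  define w where "w = M *v u - m *\<^sub>R u"
  have p_line: "p (u + t *\<^sub>R w) = - 2 * t * (norm w)\<^sup>2 + t\<^sup>2 * p w" for t
  proof -
    have "u \<bullet> (M *v w) = w \<bullet> (M *v u)"
      by (metis dot_lmul_matrix inner_commute sym vector_transpose_matrix)
    moreover have "u \<bullet> u = 1"
      using u by (simp add: norm_eq_1)
    moreover have "w \<bullet> (M *v u) = (norm w)\<^sup>2 + m * (w \<bullet> u)"
      unfolding power2_norm_eq_inner by (subst (3) w_def) (simp add: inner_diff_right)
    ultimately show ?thesis
      using m_def[symmetric] unfolding p_def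
      by (simp add: matrix_vector_right_distrib matrix_vector_mult_scaleR inner_simps
          inner_commute[of u w] power2_eq_square algebra_simps)
  qed
  have "w = 0"
  proof (rule ccontr)
    assume "w \<noteq> 0"
    then have w: "0 < (norm w)\<^sup>2" by simp
    show False
    proof (cases "p w = 0")
      case True
      then show False
        using p_line[of 1] p_nonneg[of "u + 1 *\<^sub>R w"] w by simp
    next
      case False
      then have pw: "0 < p w"
        using p_nonneg[of w] by simp
      \<comment> \<open>This value of \<open>t\<close> is the vertex of the parabola in
        \<open>p_line\<close>.\<close>
      have "p (u + ((norm w)\<^sup>2 / p w) *\<^sub>R w) = - ((norm w)\<^sup>2)\<^sup>2 / p w"
        unfolding p_line using pw by (simp add: field_simps power2_eq_square)
      also have "\<dots> < 0"
        using w pw by simp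
      finally show False
        using p_nonneg by (meson not_less)
    qed
  qed
  then have "is_eigenvalue M m"
    unfolding is_eigenvalue_def w_def using u by (intro exI[of _ u]) auto
  moreover have "\<mu> \<le> m" if eig: "is_eigenvalue M \<mu>" for \<mu>
  proof -
    obtain v where v: "v \<noteq> 0" "M *v v = \<mu> *\<^sub>R v"
      using eig by (auto simp: is_eigenvalue_def)
    then have "0 \<le> (m - \<mu>) * (v \<bullet> v)"
      using p_nonneg[of v] by (simp add: p_def algebra_simps)
    then show ?thesis
      using v by (metis inner_gt_zero_iff diff_ge_0_iff_ge zero_le_mult_iff not_less)
  qed
  ultimately have "largest_eigenvalue M = m"
    unfolding largest_eigenvalue_def by (intro Greatest_equality)
  then show ?thesis
    using p_nonneg[of v] by (simp add: p_def power2_norm_eq_inner)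
qed

lemma transpose_laplacian: "transpose A = A \<Longrightarrow> transpose (laplacian A) = laplacian A"
  by (simp add: laplacian_def degree_matrix_def transpose_def vec_eq_iff)

lemma laplacian_mult_nth:
  "(laplacian A *v v) $ i = (\<Sum>j\<in>UNIV. A $ i $ j * (v $ i - v $ j))"
proof -
  have "(degree_matrix A *v v) $ i = (\<Sum>j\<in>UNIV. A $ i $ j) * v $ i"
    by (simp add: degree_matrix_def matrix_vector_mult_def if_distrib[of "\<lambda>a. a * _"] cong: if_cong)
  then show ?thesis
    unfolding laplacian_def
    by (simp add: matrix_vector_mult_diff_rdistrib matrix_vector_mult_def[of A]
        right_diff_distrib sum_subtractf sum_distrib_right)
qed

text \<open>The all-ones vector, written \<open>1\<close>, lies in the kernel of the Laplacian, so
  the form takes the value 0 there.\<close>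

lemma laplacian_largest_eigenvalue_nonneg:
  fixes A :: "real^'n^'n"
  assumes "transpose A = A"
  shows "0 \<le> largest_eigenvalue (laplacian A)"
proof -
  have "laplacian A *v 1 = 0"
    by (simp add: vec_eq_iff laplacian_mult_nth)
  then have "0 \<le> largest_eigenvalue (laplacian A) * (norm (1 :: real^'n))\<^sup>2"
    using rayleigh_le_largest_eigenvalue[OF transpose_laplacian[OF assms], of 1] by simp
  then show ?thesis
    by (simp add: zero_le_mult_iff)
qed

section \<open>The Laplacian acting on stacked vectors\<close>

definition block_laplacian :: "real^'n^'n \<Rightarrow> (real^'d)^'n \<Rightarrow> (real^'d)^'n" where
  \<comment> \<open>the operator \<open>L \<otimes> I\<^sub>d\<close>\<close>
  "block_laplacian A x = (\<chi> i. \<Sum>j\<in>UNIV. A $ i $ j *\<^sub>R (x $ i - x $ j))"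

lemma block_laplacian_add:
  "block_laplacian A (x + y) = block_laplacian A x + block_laplacian A y"
  by (simp add: block_laplacian_def vec_eq_iff sum.distrib[symmetric] algebra_simps)

text \<open>Symmetrization: exchanging \<open>i\<close> and \<open>j\<close> turns the sum weighted
  by \<open>y $ i\<close> into minus the one weighted by \<open>y $ j\<close>. Symmetry and
  nonnegativity of the operator can be read off the result.\<close>

lemma block_laplacian_inner:
  fixes x y :: "(real^'d)^'n"
  assumes "transpose A = A"
  shows "2 * (block_laplacian A x \<bullet> y)
    = (\<Sum>i\<in>UNIV. \<Sum>j\<in>UNIV. A $ i $ j * ((x $ i - x $ j) \<bullet> (y $ i - y $ j)))"
proof -
  let ?S = "\<lambda>w. \<Sum>i\<in>UNIV. \<Sum>j\<in>UNIV. A $ i $ j * ((x $ i - x $ j) \<bullet> w i j)"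
  have A: "A $ i $ j = A $ j $ i" for i j
    using assms by (metis transpose_def vec_lambda_beta)
  have 1: "block_laplacian A x \<bullet> y = ?S (\<lambda>i j. y $ i)"
    by (simp add: block_laplacian_def inner_vec_def[where 'b = 'n] inner_sum_left)
  also have "\<dots> = (\<Sum>j\<in>UNIV. \<Sum>i\<in>UNIV. A $ i $ j * ((x $ i - x $ j) \<bullet> y $ i))"
    by (rule sum.swap)
  also have "\<dots> = - ?S (\<lambda>i j. y $ j)"
    by (simp add: sum_negf[symmetric] A inner_diff_left algebra_simps)
  finally have 2: "block_laplacian A x \<bullet> y = - ?S (\<lambda>i j. y $ j)" .
  have "?S (\<lambda>i j. y $ i - y $ j) = ?S (\<lambda>i j. y $ i) - ?S (\<lambda>i j. y $ j)"
    by (simp add: inner_diff_right right_diff_distrib sum_subtractf)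
  then show ?thesis
    using 1 2 by simp
qed

lemma block_laplacian_symmetric:
  assumes "transpose A = A"
  shows "block_laplacian A x \<bullet> y = x \<bullet> block_laplacian A y"
proof -
  have "2 * (block_laplacian A x \<bullet> y) = 2 * (block_laplacian A y \<bullet> x)"
    unfolding block_laplacian_inner[OF assms] by (simp add: inner_commute)
  then show ?thesis
    by (simp add: inner_commute)
qed

lemma block_laplacian_nonneg:
  assumes "transpose A = A" and "\<And>i j. 0 \<le> A $ i $ j"
  shows "0 \<le> block_laplacian A x \<bullet> x"
proof -
  have "0 \<le> 2 * (block_laplacian A x \<bullet> x)"
    unfolding block_laplacian_inner[OF assms(1)] by (intro sum_nonneg mult_nonneg_nonneg assms) auto
  then show ?thesis by simp
qed

text \<open>The operator acts separately on each of the coordinates \<open>c\<close> of the local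
  vectors, so the Rayleigh bound applies to every slice \<open>col c\<close> and the slices sum
  up.\<close>

lemma block_laplacian_le:
  fixes x :: "(real^'d)^'n"
  assumes "transpose A = A"
  shows "block_laplacian A x \<bullet> x \<le> largest_eigenvalue (laplacian A) * (norm x)\<^sup>2"
proof -
  define col :: "'d \<Rightarrow> real^'n" where "col c = (\<chi> i. x $ i $ c)" for c
  have "block_laplacian A x \<bullet> x
      = (\<Sum>i\<in>UNIV. \<Sum>c\<in>UNIV. (laplacian A *v col c) $ i * col c $ i)"
    by (simp add: inner_vec_def block_laplacian_def laplacian_mult_nth col_def)
  also have "\<dots> = (\<Sum>c\<in>UNIV. col c \<bullet> (laplacian A *v col c))"
    by (subst sum.swap) (simp add: inner_vec_def mult.commute)
  also have "\<dots> \<le> (\<Sum>c\<in>UNIV. largest_eigenvalue (laplacian A) * (norm (col c))\<^sup>2)"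
    by (intro sum_mono rayleigh_le_largest_eigenvalue transpose_laplacian assms)
  also have "\<dots> = largest_eigenvalue (laplacian A) * (\<Sum>c\<in>UNIV. \<Sum>i\<in>UNIV. x $ i $ c * x $ i $ c)"
    by (simp add: sum_distrib_left[symmetric] power2_norm_eq_inner inner_vec_def col_def)
  also have "(\<Sum>c\<in>UNIV. \<Sum>i\<in>UNIV. x $ i $ c * x $ i $ c) = (norm x)\<^sup>2"
    by (subst sum.swap) (simp add: power2_norm_eq_inner inner_vec_def)
  finally show ?thesis .
qed

section \<open>Norm estimate for one gradient step\<close>

text \<open>\<open>G\<close> stands for the gradient of \<open>F\<close> at \<open>x\<close>, but
  enters only through the two inequalities, so that the aggregate objective never has to be
  differentiated.\<close>

lemma gradient_step_norm_bound:
  fixes x G :: "'a::real_inner" and F :: "'a \<Rightarrow> real"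
  assumes nonneg: "\<And>y. 0 \<le> F y"
    and upper: "\<And>h. F (x + h) \<le> F x + G \<bullet> h + M / 2 * (norm h)\<^sup>2"
    and lower: "F x - G \<bullet> x + \<alpha> / 2 * (norm x)\<^sup>2 \<le> F 0"
    and "0 < M" "0 < \<eta>" "\<eta> \<le> 1 / M"
  shows "(norm (x - \<eta> *\<^sub>R G))\<^sup>2 \<le> (1 - \<eta> * \<alpha>) * (norm x)\<^sup>2 + 2 * \<eta> * F 0"
proof -
  \<comment> \<open>The displacement \<open>- G / M\<close> minimizes the quadratic upper model;
    nonnegativity of \<open>F\<close> then bounds \<open>(norm G)\<^sup>2\<close> by
    \<open>2 * M * F x\<close>.\<close>
  have "0 \<le> F (x + (- (1 / M)) *\<^sub>R G)"
    by (rule nonneg)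
  also have "\<dots> \<le> F x + G \<bullet> ((- (1 / M)) *\<^sub>R G) + M / 2 * (norm ((- (1 / M)) *\<^sub>R G))\<^sup>2"
    by (rule upper)
  also have "\<dots> = F x - 1 / M * ((norm G)\<^sup>2 / 2)"
    using \<open>0 < M\<close> by (simp add: dot_square_norm power_mult_distrib field_simps power2_eq_square)
  finally have "1 / M * ((norm G)\<^sup>2 / 2) \<le> F x"
    by simp
  moreover have "\<eta> * ((norm G)\<^sup>2 / 2) \<le> 1 / M * ((norm G)\<^sup>2 / 2)"
    using \<open>\<eta> \<le> 1 / M\<close> by (intro mult_right_mono) auto
  ultimately have "\<eta> * ((norm G)\<^sup>2 / 2) - G \<bullet> x \<le> F 0 - \<alpha> / 2 * (norm x)\<^sup>2"
    using lower by linarith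
  \<comment> \<open>The factor 2\<eta> makes the left side the increment of the squared norm in the
    step.\<close>
  then have "(2 * \<eta>) * (\<eta> * ((norm G)\<^sup>2 / 2) - G \<bullet> x) \<le> (2 * \<eta>) * (F 0 - \<alpha> / 2 * (norm x)\<^sup>2)"
    using \<open>0 < \<eta>\<close> by (intro mult_left_mono) auto
  moreover have "(norm (x - \<eta> *\<^sub>R G))\<^sup>2
      = (norm x)\<^sup>2 + (2 * \<eta>) * (\<eta> * ((norm G)\<^sup>2 / 2) - G \<bullet> x)"
    unfolding power2_norm_eq_inner
    by (simp add: inner_simps inner_commute[of x G] power2_eq_square algebra_simps)
  ultimately show ?thesis
    by (simp add: algebra_simps)
qed

text \<open>The abstract estimate is applied to the aggregate objective \<open>F\<close>: local
  bounds are summed over the agents, and the coupling term is an exact quadratic controlled by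
  \<open>lam\<close>.\<close>

lemma distributed_gradient_step_norm_bound:
  fixes A :: "real^'n^'n" and f :: "'n \<Rightarrow> real^'d \<Rightarrow> real" and x :: "(real^'d)^'n"
  defines "lam \<equiv> largest_eigenvalue (laplacian A)"
  assumes "0 < \<beta>" "0 < \<rho>"
    and A: "transpose A = A" "\<And>i j. 0 \<le> A $ i $ j"
    and f: "\<And>i. f i \<in> F_class \<alpha> \<beta>"
    and \<eta>: "0 < \<eta>" "\<eta> \<le> 1 / (\<beta> + \<rho> * lam)"
  shows "(norm (x - \<eta> *\<^sub>R ((\<chi> i. grad (f i) (x $ i)) + \<rho> *\<^sub>R block_laplacian A x)))\<^sup>2
    \<le> (1 - \<eta> * \<alpha>) * (norm x)\<^sup>2 + \<eta> * (real CARD('n) * \<beta>)"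
proof -
  let ?B = "block_laplacian A"
  define F where "F y = (\<Sum>i\<in>UNIV. f i (y $ i)) + \<rho> / 2 * (?B y \<bullet> y)" for y
  define D where "D = (\<chi> i. grad (f i) (x $ i))"
  define G where "G = D + \<rho> *\<^sub>R ?B x"
  have lam: "0 \<le> lam"
    unfolding lam_def by (rule laplacian_largest_eigenvalue_nonneg[OF A(1)])
  have norm2: "(norm v)\<^sup>2 = (\<Sum>i\<in>UNIV. (norm (v $ i))\<^sup>2)" for v :: "(real^'d)^'n"
    by (simp add: power2_norm_eq_inner inner_vec_def[where 'b = 'n])
  have D_inner: "D \<bullet> h = (\<Sum>i\<in>UNIV. grad (f i) (x $ i) \<bullet> h $ i)" for h
    by (simp add: D_def inner_vec_def[where 'b = 'n])
  have quad: "?B (x + h) \<bullet> (x + h) = ?B x \<bullet> x + 2 * (?B x \<bullet> h) + ?B h \<bullet> h" for h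
    using block_laplacian_symmetric[OF A(1), of h x]
    by (simp add: block_laplacian_add inner_simps inner_commute)
  have F_expand: "F (x + h) = (\<Sum>i\<in>UNIV. f i (x $ i + h $ i)) + \<rho> / 2 * (?B x \<bullet> x)
      + \<rho> * (?B x \<bullet> h) + \<rho> / 2 * (?B h \<bullet> h)" for h
    unfolding F_def quad by (simp add: distrib_left)
  have nonneg: "0 \<le> F y" for y
    unfolding F_def using \<open>0 < \<rho>\<close> F_class_nonneg[OF f] block_laplacian_nonneg[OF A]
    by (intro add_nonneg_nonneg sum_nonneg mult_nonneg_nonneg) auto
  have upper: "F (x + h) \<le> F x + G \<bullet> h + (\<beta> + \<rho> * lam) / 2 * (norm h)\<^sup>2" for h
  proof -
    have "(\<Sum>i\<in>UNIV. f i (x $ i + h $ i))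
        \<le> (\<Sum>i\<in>UNIV. f i (x $ i) + grad (f i) (x $ i) \<bullet> h $ i + \<beta> / 2 * (norm (h $ i))\<^sup>2)"
      by (intro sum_mono F_class_upper_bound[OF f])
    also have "\<dots> = (\<Sum>i\<in>UNIV. f i (x $ i)) + D \<bullet> h + \<beta> / 2 * (norm h)\<^sup>2"
      by (simp add: sum.distrib D_inner norm2 sum_distrib_left)
    finally have 1: "(\<Sum>i\<in>UNIV. f i (x $ i + h $ i)) \<le> \<dots>" .
    have 2: "\<rho> / 2 * (?B h \<bullet> h) \<le> \<rho> / 2 * (lam * (norm h)\<^sup>2)"
      unfolding lam_def using \<open>0 < \<rho>\<close> by (intro mult_left_mono block_laplacian_le[OF A(1)]) auto
    show ?thesis
      using 1 2 unfolding F_expand by (simp add: F_def G_def inner_add_left add_divide_distrib distrib_right)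
  qed
  \<comment> \<open>The local lower bounds are taken in direction \<open>- x\<close>. The coupling
    contributes \<open>- \<rho> / 2 * (?B x \<bullet> x)\<close> to
    \<open>F x - G \<bullet> x\<close>, which is at most 0.\<close>
  have lower: "F x - G \<bullet> x + \<alpha> / 2 * (norm x)\<^sup>2 \<le> F 0"
  proof -
    have "(\<Sum>i\<in>UNIV. f i (x $ i) + grad (f i) (x $ i) \<bullet> (- x) $ i + \<alpha> / 2 * (norm ((- x) $ i))\<^sup>2)
        \<le> (\<Sum>i\<in>UNIV. f i (x $ i + (- x) $ i))"
      by (intro sum_mono F_class_lower_bound[OF f])
    then have "(\<Sum>i\<in>UNIV. f i (x $ i)) - D \<bullet> x + \<alpha> / 2 * (norm x)\<^sup>2 \<le> (\<Sum>i\<in>UNIV. f i 0)"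
      by (simp add: sum.distrib sum_subtractf D_inner norm2 sum_distrib_left)
    moreover have "0 \<le> \<rho> * (?B x \<bullet> x)"
      using \<open>0 < \<rho>\<close> block_laplacian_nonneg[OF A, of x] by simp
    ultimately show ?thesis
      by (simp add: F_def G_def inner_add_left)
  qed
  have "F 0 = (\<Sum>i\<in>UNIV. f i 0)"
    by (simp add: F_def)
  also have "\<dots> \<le> (\<Sum>i\<in>(UNIV::'n set). \<beta> / 2)"
    by (intro sum_mono F_class_at_0[OF f \<open>0 < \<beta>\<close>])
  finally have F0: "2 * F 0 \<le> real CARD('n) * \<beta>"
    by simp
  have "0 < \<beta> + \<rho> * lam"
    using \<open>0 < \<beta>\<close> \<open>0 < \<rho>\<close> lam by (simp add: add_pos_nonneg)
  then have "(norm (x - \<eta> *\<^sub>R G))\<^sup>2 \<le> (1 - \<eta> * \<alpha>) * (norm x)\<^sup>2 + 2 * \<eta> * F 0"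
    using nonneg upper lower \<eta> by (intro gradient_step_norm_bound)
  also have "2 * \<eta> * F 0 \<le> \<eta> * (real CARD('n) * \<beta>)"
    using mult_left_mono[OF F0, of \<eta>] \<eta> by simp
  finally show ?thesis
    by (simp add: G_def D_def)
qed

section \<open>Invariance of the ball under the iteration\<close>

theorem theorem4:
  fixes \<alpha> \<beta> \<rho> \<eta> lam \<kappa>_\<rho> \<kappa> R :: real
    and A :: "real^'n^'n"
    and f :: "'n \<Rightarrow> nat \<Rightarrow> real^'d \<Rightarrow> real"
    and x :: "nat \<Rightarrow> (real^'d)^'n"
    and k0 :: nat
  assumes "0 < \<alpha>" and "\<alpha> \<le> \<beta>" and "0 < \<rho>"
    and "mixing_matrix A"
    and "lam = largest_eigenvalue (laplacian A)"
    and "\<And>i k. f i k \<in> F_class \<alpha> \<beta>"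
    and "0 < \<eta>" and "\<eta> \<le> 1 / (\<beta> + \<rho> * lam)"
    and "\<And>k i. x (Suc k) $ i = x k $ i - \<eta> *\<^sub>R (grad (f i k) (x k $ i)
            + \<rho> *\<^sub>R (\<Sum>j\<in>UNIV. A $ i $ j *\<^sub>R (x k $ i - x k $ j)))"
    and "\<kappa>_\<rho> = (\<beta> + \<rho> * lam) / \<alpha>"
    and "\<kappa> = \<beta> / \<alpha>"
    and "R = (if \<kappa>_\<rho> < 3
            then (1 + sqrt 6) * sqrt (real CARD('n)) * (1 + sqrt \<kappa>)
            else (1 + sqrt (2 * \<kappa>_\<rho>)) * sqrt (real CARD('n)) * (1 + sqrt \<kappa>))"
    and "norm (x k0) \<le> R"
  shows "\<forall>k\<ge>k0. norm (x k) \<le> R"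
proof -
  have A: "transpose A = A" "\<And>i j. 0 \<le> A $ i $ j"
    using assms(4) by (auto simp: mixing_matrix_def)
  have \<beta>: "0 < \<beta>"
    using assms(1,2) by simp
  have lam: "0 \<le> lam"
    unfolding assms(5) by (rule laplacian_largest_eigenvalue_nonneg[OF A(1)])
  \<comment> \<open>This keeps the factor \<open>1 - \<eta> * \<alpha>\<close> nonnegative, so that
    the bound on \<open>norm (x k)\<close> can be inserted under it.\<close>
  have \<eta>\<alpha>: "\<eta> * \<alpha> \<le> 1"
  proof -
    have "\<eta> * \<alpha> \<le> \<eta> * (\<beta> + \<rho> * lam)"
      using assms(2,3,7) lam by (intro mult_left_mono) (auto intro: add_increasing2)
    also have "\<dots> \<le> 1"
      using assms(3,8) \<beta> lam by (simp add: pos_le_divide_eq add_pos_nonneg)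
    finally show ?thesis .
  qed
  \<comment> \<open>Both branches of \<open>R\<close> have the form
    \<open>(1 + s) * sqrt n * (1 + sqrt \<kappa>)\<close> with \<open>s\<close> nonnegative; only
    this crude lower bound enters the argument.\<close>
  have R: "sqrt (real CARD('n)) * sqrt \<kappa> \<le> R"
  proof -
    have \<kappa>: "0 \<le> \<kappa>" "0 \<le> \<kappa>_\<rho>"
      using assms(1,3,10,11) \<beta> lam by auto
    have "sqrt (real CARD('n)) * sqrt \<kappa> \<le> (1 + s) * sqrt (real CARD('n)) * (1 + sqrt \<kappa>)"
      if "0 \<le> s" for s
      using that \<kappa> by (intro mult_mono) (auto simp: mult_le_cancel_right1)
    then show ?thesis
      using \<kappa> unfolding assms(12) by simp
  qed
  have R0: "0 \<le> R"
    using assms(13) norm_ge_zero order_trans by blast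
  have "real CARD('n) * \<kappa> \<le> R\<^sup>2"
  proof -
    have "0 \<le> \<kappa>"
      using assms(1,11) \<beta> by simp
    then have "(sqrt (real CARD('n)) * sqrt \<kappa>)\<^sup>2 \<le> R\<^sup>2"
      using R by (intro power_mono) auto
    then show ?thesis
      using \<open>0 \<le> \<kappa>\<close> by (simp add: power_mult_distrib)
  qed
  then have nR: "real CARD('n) * \<beta> \<le> \<alpha> * R\<^sup>2"
    using assms(1,11) by (simp add: field_simps)
  have step: "norm (x (Suc k)) \<le> R" if k: "norm (x k) \<le> R" for k
  proof -
    have "x (Suc k) = x k - \<eta> *\<^sub>R ((\<chi> i. grad (f i k) (x k $ i)) + \<rho> *\<^sub>R block_laplacian A (x k))"
      by (simp add: vec_eq_iff[where 'b = 'n] assms(9) block_laplacian_def)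
    then have "(norm (x (Suc k)))\<^sup>2
        \<le> (1 - \<eta> * \<alpha>) * (norm (x k))\<^sup>2 + \<eta> * (real CARD('n) * \<beta>)"
      using distributed_gradient_step_norm_bound[of \<beta> \<rho> A "\<lambda>i. f i k" \<alpha> \<eta> "x k"]
        \<beta> assms(3,5,6,7,8) A by simp
    \<comment> \<open>By \<open>nR\<close> the additive term is at most
      \<open>\<eta> * \<alpha> * R\<^sup>2\<close>, exactly what the contraction loses at radius
      \<open>R\<close>.\<close>
    also have "\<dots> \<le> (1 - \<eta> * \<alpha>) * R\<^sup>2 + \<eta> * (\<alpha> * R\<^sup>2)"
      using k nR \<eta>\<alpha> assms(7) by (intro add_mono mult_left_mono power_mono) auto
    also have "\<dots> = R\<^sup>2"
      by (simp add: algebra_simps)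
    finally show ?thesis
      using R0 by (rule power2_le_imp_le)
  qed
  show ?thesis
  proof (intro allI impI)
    fix k
    assume "k0 \<le> k"
    then show "norm (x k) \<le> R"
      by (induction rule: dec_induct) (use assms(13) step in auto)
  qed
qed

end
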